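(* Let assumptions $(\mathcal B_1)_\lambda$–$(\mathcal B_8)_\lambda$ listed in the context be satisfied, and let $\omega_0:=\min_{u\in\mathcal K_{\lambda_0}}b^\top u$. Then for any $\omega\ge\omega_0$ there exist $\lambda_\omega\in[\lambda_0,\lambda^*]\cap\mathbb R$ and $u_\omega\in\mathbb R^n$ such that $$F_{\lambda_\omega}(u_\omega)=b,\qquad b^\top u_\omega=\omega .$$ The mapping $\psi\colon\omega\mapsto\lambda_\omega$ (generally multi-valued: $\psi(\omega)$ is the set of all such $\lambda_\omega$) is nondecreasing (i.e., $\omega_1<\omega_2$, $\lambda_1\in\psi(\omega_1)$, $\lambda_2\in\psi(\omega_2)$ imply $\lambda_1\le\lambda_2$) and $\psi(\omega)\to\lambda^*$ as $\omega\to+\infty$. If, moreover, $(\mathcal B_8)^+_\lambda$ is satisfied, then $\psi$ is a single-valued and continuous function on $[\omega_0,+\infty)$.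
   Context: Let $\lambda_0\in[0,1]$, $b\in\mathbb R^n$, and for each real $\lambda\ge\lambda_0$ let $F_\lambda\colon\mathbb R^n\to\mathbb R^n$. $\|\cdot\|$ is the Euclidean norm; a function $g$ on $\mathbb R^n$ is coercive if $g(v)\to+\infty$ as $\|v\|\to+\infty$. Assumptions: $(\mathcal B_1)_\lambda$ $b\neq0$, and for all $\lambda\ge\lambda_0$: $F_\lambda(0)=0$ and $F_\lambda$ is continuous in $\mathbb R^n$. $(\mathcal B_2)_\lambda$ For every $\lambda\ge\lambda_0$ there is a convex, continuously differentiable $\mathcal I_\lambda\colon\mathbb R^n\to\mathbb R$ with $\nabla\mathcal I_\lambda=F_\lambda$ and $\mathcal I_\lambda(0)=0$. Put $\mathcal J_\lambda(v)=\mathcal I_\lambda(v)-b^\top v$ and let $\mathcal K_\lambda=\{u\in\mathbb R^n: F_\lambda(u)=b\}$, which is the set of minimizers of $\mathcal J_\lambda$. Let $\lambda^*\in[\lambda_0,+\infty]$ be the supremum of all $\bar\lambda\ge\lambda_0$ such that $\mathcal K_\lambda\ne\emptyset$ for every $\lambda\in[\lambda_0,\bar\lambda]$. $(\mathcal B_3)_\lambda$ (i) $\mathcal J_{\lambda_0}$ is coercive in $\mathbb R^n$. (ii) If $\mathcal J_{\bar\lambda}$ is bounded from below in $\mathbb R^n$ for some $\bar\lambda>\lambda_0$, then $\mathcal J_\lambda$ is coercive for every $\lambda\in[\lambda_0,\bar\lambda)$. (iii) If $\mathcal J_{\bar\lambda}$ is coercive for some $\bar\lambda\ge\lambda_0$,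 then there exists $\epsilon>0$ such that $\mathcal J_{\bar\lambda+\epsilon}$ is also coercive. $(\mathcal B_4)_\lambda$ For any $\lambda\ge\lambda_0$ there exist $c_{1,\lambda}>0$, $c_{2,\lambda}\ge0$ such that $\mathcal I_\lambda(v)\ge c_{1,\lambda}\|v\|-c_{2,\lambda}$ for all $v\in\mathbb R^n$. $(\mathcal B_5)_\lambda$ For any $v\in\mathbb R^n$ the function $\lambda\mapsto\mathcal I_\lambda(v)$ is nonincreasing on $[\lambda_0,+\infty)$. $(\mathcal B_6)_\lambda$ For any sequences $\lambda_n\ge\lambda_0$, $v_n\in\mathbb R^n$ with $\lambda_n\to\lambda$ and $v_n\to v$, one has $\lim_{n\to\infty}\mathcal I_{\lambda_n}(v_n)=\mathcal I_\lambda(v)$. $(\mathcal B_7)_\lambda$ For any $\lambda\ge\lambda_0$ there exists $v_\lambda\in\mathbb R^n$ such that $\lim_{\lambda\to+\infty}\mathcal J_\lambda(v_\lambda)=-\infty$. $(\mathcal B_8)_\lambda$ If $\lambda_0\le\lambda_1<\lambda_2$ (or any $\lambda_1<\lambda_2$ in $[\lambda_0,+\infty)$) and $\mathcal K_{\lambda_i}\ne\emptyset$, $i=1,2$, then $b^\top u_1\le b^\top u_2$ for any $u_1\in\mathcal K_{\lambda_1}$, $u_2\in\mathcal K_{\lambda_2}$. $(\mathcal B_8)^+_\lambda$ The same as $(\mathcal B_8)_\lambda$ with the strict inequality $b^\top u_1<b^\top u_2$. *)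

theory Defs
  imports "HOL-Analysis.Analysis"
begin

definition coercive :: "('a::real_normed_vector \<Rightarrow> real) \<Rightarrow> bool" where
  "coercive g \<longleftrightarrow> filterlim g at_top at_infinity"

definition J_fun :: "(real \<Rightarrow> 'a::real_inner \<Rightarrow> real) \<Rightarrow> 'a \<Rightarrow> real \<Rightarrow> 'a \<Rightarrow> real" where
  "J_fun I b l v = I l v - b \<bullet> v"

definition K_set :: "(real \<Rightarrow> 'a \<Rightarrow> 'a) \<Rightarrow> 'a \<Rightarrow> real \<Rightarrow> 'a set" where
  "K_set F b l = {u. F l u = b}"

text \<open>The supremum is taken in the extended reals, so it may be infinite.  If the equation is
  solvable at \<open>l0\<close>, the set is nonempty and the supremum is at least \<open>l0\<close>.\<close>

definition lambda_star :: "(real \<Rightarrow> 'a \<Rightarrow> 'a) \<Rightarrow> 'a \<Rightarrow> real \<Rightarrow> ereal" where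
  "lambda_star F b l0 = Sup (ereal ` {m. l0 \<le> m \<and> (\<forall>l\<in>{l0..m}. K_set F b l \<noteq> {})})"

text \<open>\<open>LEAST\<close> is the minimum only where one exists; statements using this constant
  should also assert that the minimum is attained.\<close>

definition omega0 :: "(real \<Rightarrow> 'a::real_inner \<Rightarrow> 'a) \<Rightarrow> 'a \<Rightarrow> real \<Rightarrow> real" where
  "omega0 F b l0 = (LEAST w. w \<in> (\<lambda>u. b \<bullet> u) ` K_set F b l0)"

definition psi :: "(real \<Rightarrow> 'a::real_inner \<Rightarrow> 'a) \<Rightarrow> 'a \<Rightarrow> real \<Rightarrow> real \<Rightarrow> real set" where
  "psi F b l0 w =
     {l. l0 \<le> l \<and> ereal l \<le> lambda_star F b l0 \<and> (\<exists>u. F l u = b \<and> b \<bullet> u = w)}"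

text \<open>Convergence of a set-valued map to a point: eventually all values lie in any given
  neighbourhood of the point.  For singleton values this is ordinary convergence; empty
  values are not excluded.\<close>

definition multi_tendsto :: "('a \<Rightarrow> 'b::topological_space set) \<Rightarrow> 'b \<Rightarrow> 'a filter \<Rightarrow> bool" where
  "multi_tendsto \<Phi> y Z \<longleftrightarrow>
     (\<forall>U. open U \<longrightarrow> y \<in> U \<longrightarrow> eventually (\<lambda>x. \<Phi> x \<subseteq> U) Z)"

end

theory Submission
  imports Defs
begin

text \<open>
  The solutions of \<open>F l u = b\<close> are the minimizers of the convex function \<open>J_fun I b l\<close>. Two facts
  carry the proof.

  The first is a compactness property: the pairs \<open>(l, u)\<close> that solve the equation with \<open>l\<close> in a
  bounded interval and \<open>b \<bullet> u\<close> bounded above form a compact set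
  (\<open>compact_bounded_solutions\<close>). It is bounded because a minimizer satisfies
  \<open>I l u \<le> b \<bullet> u\<close>, while \<open>I\<close> at the right end of the interval is a lower bound for \<open>I l\<close> with
  linear growth. It is closed because minimality passes to the limit in both variables.

  The second is that a convex function whose minimizers form a nonempty bounded set is coercive
  (\<open>coercive_if_bounded_minimizers\<close>).

  For a level \<open>w\<close> above the least value of \<open>b \<bullet> u\<close> at \<open>l0\<close>, let \<open>m\<close> be the largest parameter that
  admits a solution with \<open>b \<bullet> u \<le> w\<close>. It exists by compactness, since at such a parameter the
  minimum of \<open>J\<close> is at least \<open>- w\<close>, which fails for large parameters. If all
  solutions at \<open>m\<close> had \<open>b \<bullet> u < w\<close>, they would form a bounded set, so \<open>J\<close> would be coercive at \<open>m\<close>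
  and hence up to some \<open>m + \<epsilon>\<close>. Solutions at parameters decreasing to \<open>m\<close> have \<open>b \<bullet> u > w\<close> by the
  choice of \<open>m\<close>, and they accumulate at a solution at \<open>m\<close> with \<open>b \<bullet> u \<ge> w\<close>, a contradiction. Since the
  solution set at \<open>m\<close> is convex, the value \<open>w\<close> itself is taken there. This covers uniformly
  the cases of an infinite \<open>lambda_star\<close>, of a finite one where the equation is solvable and of a
  finite one where it is not. That \<open>m\<close> is at most \<open>lambda_star\<close> is clear afterwards: solvability
  at \<open>m\<close> bounds \<open>J\<close> from below there, which makes \<open>J\<close> coercive at all smaller parameters.

  The monotonicity of \<open>psi\<close> is the monotonicity of \<open>b \<bullet> u\<close> read backwards, and the limit at
  infinity follows from it. In the strict case \<open>psi\<close> is single-valued, and its graph over a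
  compact interval is a continuous image of one of the compact sets above; a function into a
  compact set with closed graph is continuous.
\<close>

section \<open>Convex functions and their minimizers\<close>

text \<open>Restricted to the line through \<open>u\<close> and \<open>v\<close>, a convex function lies above its tangent,
  which is horizontal at a zero of the gradient.\<close>

lemma gradient_zero_iff_minimizer:
  fixes f :: "'a::real_inner \<Rightarrow> real"
  assumes convex: "convex_on UNIV f" and deriv: "GDERIV f u :> D"
  shows "D = 0 \<longleftrightarrow> (\<forall>v. f u \<le> f v)"
proof
  assume "D = 0"
  show "\<forall>v. f u \<le> f v"
  proof
    fix v
    define \<phi> where "\<phi> t = f (u + t *\<^sub>R (v - u))" for t :: real
    have "convex_on UNIV \<phi>"
    proof (rule convex_onI)
      fix t x y :: real assume "0 < t" "t < 1"
      have "u + ((1 - t) *\<^sub>R x + t *\<^sub>R y) *\<^sub>R (v - u)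
          = (1 - t) *\<^sub>R (u + x *\<^sub>R (v - u)) + t *\<^sub>R (u + y *\<^sub>R (v - u))"
        by (simp add: algebra_simps)
      then show "\<phi> ((1 - t) *\<^sub>R x + t *\<^sub>R y) \<le> (1 - t) * \<phi> x + t * \<phi> y"
        unfolding \<phi>_def using convex_onD[OF convex, of t] \<open>0 < t\<close> \<open>t < 1\<close> by simp
    qed simp
    moreover have "(\<phi> has_field_derivative 0) (at 0 within UNIV)"
    proof -
      have "(f has_derivative (\<lambda>h. 0)) (at (u + 0 *\<^sub>R (v - u)))"
        using deriv \<open>D = 0\<close> by (simp add: gderiv_def)
      moreover have "((\<lambda>t. u + t *\<^sub>R (v - u)) has_derivative (\<lambda>h. h *\<^sub>R (v - u))) (at 0)"
        by (auto intro!: derivative_eq_intros)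
      ultimately have "(\<phi> has_derivative (\<lambda>h. 0)) (at 0)"
        unfolding \<phi>_def using has_derivative_compose by fastforce
      then show ?thesis
        by (simp add: has_field_derivative_def lambda_zero)
    qed
    ultimately have "\<phi> 1 - \<phi> 0 \<ge> 0 * (1 - 0)"
      by (intro convex_on_imp_above_tangent[where A = UNIV]) auto
    then show "f u \<le> f v"
      by (simp add: \<phi>_def)
  qed
next
  assume "\<forall>v. f u \<le> f v"
  then have "(\<lambda>h. h \<bullet> D) = (\<lambda>h. 0)"
    using deriv by (intro has_derivative_local_min[of f _ u]) (auto simp: gderiv_def)
  then have "D \<bullet> D = 0"
    by metis
  then show "D = 0"
    by simp
qed

lemma convex_minimizers:
  assumes "convex_on UNIV f"
  shows "convex {u. \<forall>v. f u \<le> f v}"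
proof (rule convexI)
  fix x y and s t :: real
  assume min: "x \<in> {u. \<forall>v. f u \<le> f v}" "y \<in> {u. \<forall>v. f u \<le> f v}"
    and st: "0 \<le> s" "0 \<le> t" "s + t = 1"
  have "f (s *\<^sub>R x + t *\<^sub>R y) \<le> f v" for v
  proof -
    have "f (s *\<^sub>R x + t *\<^sub>R y) \<le> s * f x + t * f y"
      using assms st by (simp add: convex_on_def)
    also have "\<dots> \<le> f v"
      using min st by (intro convex_bound_le) auto
    finally show ?thesis .
  qed
  then show "s *\<^sub>R x + t *\<^sub>R y \<in> {u. \<forall>v. f u \<le> f v}"
    by blast
qed

lemma coercive_attains_min:
  fixes f :: "'a::euclidean_space \<Rightarrow> real"
  assumes "continuous_on UNIV f" "coercive f"
  shows "\<exists>u. \<forall>v. f u \<le> f v"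
proof -
  obtain r where r: "\<And>v. r \<le> norm v \<Longrightarrow> f 0 \<le> f v"
    using assms(2) unfolding coercive_def filterlim_at_top eventually_at_infinity by metis
  have "continuous_on (cball 0 \<bar>r\<bar>) f"
    using assms(1) continuous_on_subset by blast
  moreover have "cball (0 :: 'a) \<bar>r\<bar> \<noteq> {}"
    by simp
  ultimately obtain u where u: "\<And>v. v \<in> cball 0 \<bar>r\<bar> \<Longrightarrow> f u \<le> f v"
    using continuous_attains_inf[of "cball 0 \<bar>r\<bar>" f] compact_cball by blast
  have "f u \<le> f v" for v
  proof (cases "norm v \<le> \<bar>r\<bar>")
    case False
    then have "f 0 \<le> f v"
      by (intro r) auto
    moreover have "f u \<le> f 0"
      by (rule u) simp
    ultimately show ?thesis
      by simp
  qed (auto intro: u)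
  then show ?thesis
    by blast
qed

text \<open>On a sphere that encloses all minimizers the function exceeds its minimum by some
  \<open>\<delta> > 0\<close>. By convexity along rays it therefore grows outside the sphere at least linearly.\<close>

lemma coercive_if_bounded_minimizers:
  fixes f :: "'a::euclidean_space \<Rightarrow> real"
  assumes convex: "convex_on UNIV f" and cont: "continuous_on UNIV f"
    and min: "\<And>v. f x \<le> f v" and bounded: "bounded {u. \<forall>v. f u \<le> f v}"
  shows "coercive f"
proof -
  obtain r where r: "\<And>u. (\<forall>v. f u \<le> f v) \<Longrightarrow> dist x u \<le> r"
    using bounded unfolding bounded_any_center[where a = x] by blast
  define R where "R = r + 1"
  have R: "R > 0" "\<And>u. (\<forall>v. f u \<le> f v) \<Longrightarrow> dist x u < R"
    using r[of x] r min by (force simp: R_def)+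
  have "sphere x R \<noteq> {}"
    using R(1) by simp
  moreover have "continuous_on (sphere x R) f"
    using cont continuous_on_subset by blast
  ultimately obtain p where p: "p \<in> sphere x R" "\<And>y. y \<in> sphere x R \<Longrightarrow> f p \<le> f y"
    using continuous_attains_inf[of "sphere x R" f] by auto
  define \<delta> where "\<delta> = f p - f x"
  have "f x < f p"
  proof (rule ccontr)
    assume "\<not> f x < f p"
    then have "dist x p < R"
      using min by (intro R(2)) (meson not_less order_trans)
    then show False
      using p(1) by simp
  qed
  then have "\<delta> > 0"
    by (simp add: \<delta>_def)
  have growth: "f x + \<delta> * norm (v - x) / R \<le> f v" if "R \<le> norm (v - x)" for v
  proof -
    define t where "t = R / norm (v - x)"
    define y where "y = (1 - t) *\<^sub>R x + t *\<^sub>R v"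
    have pos: "norm (v - x) > 0"
      using that R(1) by linarith
    have t: "0 < t" "t \<le> 1"
      using that R(1) pos by (auto simp: t_def)
    have "y - x = t *\<^sub>R (v - x)"
      by (simp add: y_def algebra_simps)
    then have "dist x y = R"
      using t(1) pos by (simp add: dist_norm norm_minus_commute[of x y] t_def R(1) less_imp_le)
    then have "f x + \<delta> \<le> f y"
      using p(2) by (simp add: \<delta>_def)
    also have "f y \<le> (1 - t) * f x + t * f v"
      unfolding y_def using convex_onD[OF convex, of t] t by simp
    finally have "\<delta> \<le> t * (f v - f x)"
      by (simp add: algebra_simps)
    then have "\<delta> / t \<le> f v - f x"
      using t(1) by (simp add: pos_divide_le_eq mult.commute)
    then show ?thesis
      by (simp add: t_def)
  qed
  show ?thesis
    unfolding coercive_def filterlim_at_top eventually_at_infinity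
  proof
    fix Z
    have "Z \<le> f v" if v: "norm x + max R (R * (Z - f x) / \<delta>) \<le> norm v" for v
    proof -
      have "max R (R * (Z - f x) / \<delta>) \<le> norm (v - x)"
        using v norm_triangle_ineq2[of v x] by linarith
      then have *: "R \<le> norm (v - x)" "R * (Z - f x) / \<delta> \<le> norm (v - x)"
        by auto
      from *(2) have "Z \<le> f x + \<delta> * norm (v - x) / R"
        using \<open>\<delta> > 0\<close> R(1) by (simp add: field_simps)
      with growth[OF *(1)] show ?thesis
        by linarith
    qed
    then show "\<exists>r. \<forall>v. r \<le> norm v \<longrightarrow> Z \<le> f v"
      by blast
  qed
qed

lemma coercive_mono:
  assumes "coercive f" "\<And>v. f v \<le> g v"
  shows "coercive g"
  using assms unfolding coercive_def by (auto intro: filterlim_at_top_mono)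

section \<open>Nonincreasing families of convex potentials\<close>

locale convex_potential_family =
  fixes l0 :: real
    and b :: "'a::euclidean_space"
    and F :: "real \<Rightarrow> 'a \<Rightarrow> 'a"
    and I :: "real \<Rightarrow> 'a \<Rightarrow> real"
  assumes F_zero: "\<And>l. l0 \<le> l \<Longrightarrow> F l 0 = 0"
    and convex_I: "\<And>l. l0 \<le> l \<Longrightarrow> convex_on UNIV (I l)"
    and gradient_I: "\<And>l v. l0 \<le> l \<Longrightarrow> GDERIV (I l) v :> F l v"
    and I_zero: "\<And>l. l0 \<le> l \<Longrightarrow> I l 0 = 0"
    and linear_growth: "\<And>l. l0 \<le> l \<Longrightarrow> \<exists>c1 c2. c1 > 0 \<and> c2 \<ge> 0 \<and> (\<forall>v. I l v \<ge> c1 * norm v - c2)"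
    and antimono_I: "\<And>v l1 l2. l0 \<le> l1 \<Longrightarrow> l1 \<le> l2 \<Longrightarrow> I l2 v \<le> I l1 v"
    and joint_limit_I: "\<And>ls l vs v. (\<And>n::nat. l0 \<le> ls n) \<Longrightarrow> ls \<longlonglongrightarrow> l \<Longrightarrow> vs \<longlonglongrightarrow> v
      \<Longrightarrow> (\<lambda>n. I (ls n) (vs n)) \<longlonglongrightarrow> I l v"
begin

abbreviation "J \<equiv> J_fun I b"
abbreviation "K \<equiv> K_set F b"

lemma convex_J:
  assumes "l0 \<le> l"
  shows "convex_on UNIV (J l)"
proof (rule convex_onI)
  fix t x y assume "0 < t" "t < (1::real)"
  then show "J l ((1 - t) *\<^sub>R x + t *\<^sub>R y) \<le> (1 - t) * J l x + t * J l y"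
    using convex_onD[OF convex_I[OF assms], of t x y]
    by (simp add: J_fun_def inner_add_right algebra_simps)
qed simp

lemma gradient_J:
  assumes "l0 \<le> l"
  shows "GDERIV (J l) v :> F l v - b"
proof -
  have "GDERIV (\<lambda>v. b \<bullet> v) v :> b"
    unfolding gderiv_def by (auto intro!: derivative_eq_intros simp: inner_commute)
  from GDERIV_diff[OF gradient_I[OF assms] this] show ?thesis
    by (simp add: J_fun_def[abs_def])
qed

lemma continuous_on_J:
  assumes "l0 \<le> l"
  shows "continuous_on UNIV (J l)"
  using gradient_J[OF assms] unfolding gderiv_def
  by (meson continuous_at_imp_continuous_on has_derivative_continuous)

lemma K_iff_minimizer:
  assumes "l0 \<le> l"
  shows "u \<in> K l \<longleftrightarrow> (\<forall>v. J l u \<le> J l v)"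
  using gradient_zero_iff_minimizer[OF convex_J[OF assms] gradient_J[OF assms]]
  by (simp add: K_set_def)

lemma K_eq_minimizers:
  assumes "l0 \<le> l"
  shows "K l = {u. \<forall>v. J l u \<le> J l v}"
  using K_iff_minimizer[OF assms] by auto

lemma connected_K:
  assumes "l0 \<le> l"
  shows "connected (K l)"
  unfolding K_eq_minimizers[OF assms]
  by (intro convex_connected convex_minimizers convex_J assms)

lemma I_nonneg:
  assumes "l0 \<le> l"
  shows "0 \<le> I l v"
  using gradient_zero_iff_minimizer[OF convex_I[OF assms] gradient_I[OF assms], of 0]
    F_zero[OF assms] I_zero[OF assms] by metis

lemma I_le_inner_if_K:
  assumes "l0 \<le> l" "u \<in> K l"
  shows "I l u \<le> b \<bullet> u"
proof -
  have "J l u \<le> J l 0"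
    using assms K_iff_minimizer by blast
  then show ?thesis
    by (simp add: J_fun_def I_zero[OF assms(1)])
qed

lemma coercive_imp_K_nonempty:
  assumes "l0 \<le> l" "coercive (J l)"
  shows "K l \<noteq> {}"
  using coercive_attains_min[OF continuous_on_J[OF assms(1)] assms(2)] K_iff_minimizer[OF assms(1)]
  by blast

lemma coercive_J_antimono:
  assumes "l0 \<le> l" "l \<le> m" "coercive (J m)"
  shows "coercive (J l)"
  using assms(3) by (rule coercive_mono) (simp add: J_fun_def antimono_I assms)

definition bounded_solutions :: "real \<Rightarrow> real \<Rightarrow> (real \<times> 'a) set" where
  "bounded_solutions M W = {(l, u). l \<in> {l0..M} \<and> u \<in> K l \<and> b \<bullet> u \<le> W}"

lemma bounded_bounded_solutions:
  shows "bounded (bounded_solutions M W)"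
proof (cases "l0 \<le> M")
  case True
  then obtain c1 c2 where c: "c1 > 0" "\<And>v. c1 * norm v - c2 \<le> I M v"
    using linear_growth by blast
  have "u \<in> cball 0 ((W + c2) / c1)" if "(l, u) \<in> bounded_solutions M W" for l u
  proof -
    from that have lu: "l0 \<le> l" "l \<le> M" "u \<in> K l" "b \<bullet> u \<le> W"
      by (auto simp: bounded_solutions_def)
    have "c1 * norm u - c2 \<le> I M u"
      by (rule c(2))
    also have "\<dots> \<le> I l u"
      using lu by (intro antimono_I)
    also have "\<dots> \<le> b \<bullet> u"
      using lu by (intro I_le_inner_if_K)
    finally show ?thesis
      using lu(4) c(1) by (simp add: field_simps)
  qed
  then have "bounded_solutions M W \<subseteq> {l0..M} \<times> cball 0 ((W + c2) / c1)"
    unfolding bounded_solutions_def by blast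
  then show ?thesis
    by (rule bounded_subset[rotated]) (intro bounded_Times bounded_closed_interval bounded_cball)
qed (simp add: bounded_solutions_def)

text \<open>Boundedness comes from \<open>I M u \<le> I l u \<le> b \<bullet> u \<le> W\<close> for \<open>l \<le> M\<close> and the linear growth of
  \<open>I M\<close>. Closedness comes from passing to the limit in \<open>J l u \<le> J l v\<close> for each fixed \<open>v\<close>.\<close>

lemma compact_bounded_solutions:
  "compact (bounded_solutions M W)"
proof -
  have "closed (bounded_solutions M W)"
    unfolding closed_sequential_limits
  proof (intro allI impI, elim conjE)
    fix s p
    assume s: "\<forall>n. s n \<in> bounded_solutions M W" and lim: "s \<longlonglongrightarrow> p"
    define ls us where "ls n = fst (s n)" and "us n = snd (s n)" for n
    obtain l u where p: "p = (l, u)"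
      by fastforce
    have ls: "ls \<longlonglongrightarrow> l" and us: "us \<longlonglongrightarrow> u"
      using tendsto_fst[OF lim] tendsto_snd[OF lim] by (simp_all add: p ls_def[abs_def] us_def[abs_def])
    have mem: "l0 \<le> ls n" "ls n \<le> M" "us n \<in> K (ls n)" "b \<bullet> us n \<le> W" for n
      using s by (auto simp: bounded_solutions_def ls_def us_def case_prod_unfold)
    have l: "l0 \<le> l" "l \<le> M"
      using mem ls LIMSEQ_le_const[of ls] LIMSEQ_le_const2[of ls] by blast+
    have "b \<bullet> u \<le> W"
      using mem(4) by (intro LIMSEQ_le_const2[OF tendsto_inner[OF tendsto_const us]]) blast
    moreover have "J l u \<le> J l v" for v
    proof -
      have "(\<lambda>n. J (ls n) (us n)) \<longlonglongrightarrow> J l u"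
        unfolding J_fun_def
        by (intro tendsto_diff joint_limit_I mem ls us tendsto_inner tendsto_const)
      moreover have "(\<lambda>n. J (ls n) v) \<longlonglongrightarrow> J l v"
        unfolding J_fun_def
        by (intro tendsto_diff joint_limit_I mem ls tendsto_inner tendsto_const)
      moreover have "J (ls n) (us n) \<le> J (ls n) v" for n
        using mem K_iff_minimizer by blast
      ultimately show ?thesis
        by (blast intro: LIMSEQ_le)
    qed
    ultimately show "p \<in> bounded_solutions M W"
      using l K_iff_minimizer by (simp add: p bounded_solutions_def)
  qed
  with bounded_bounded_solutions show ?thesis
    by (simp add: compact_eq_bounded_closed)
qed

text \<open>Only the part of \<open>K l\<close> with \<open>b \<bullet> v \<le> b \<bullet> w\<close>, for some \<open>w \<in> K l\<close>, matters for the minimum, and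
  that part is compact.\<close>

lemma inner_attains_min_on_K:
  assumes "l0 \<le> l" "K l \<noteq> {}"
  shows "\<exists>u\<in>K l. \<forall>v\<in>K l. b \<bullet> u \<le> b \<bullet> v"
proof -
  obtain w where w: "w \<in> K l"
    using assms by blast
  let ?S = "bounded_solutions l (b \<bullet> w) \<inter> {l} \<times> UNIV"
  have "compact ?S"
    by (intro compact_Int_closed compact_bounded_solutions closed_Times) auto
  moreover have "(l, w) \<in> ?S"
    using w assms by (simp add: bounded_solutions_def)
  ultimately obtain p where p: "p \<in> ?S" "\<And>q. q \<in> ?S \<Longrightarrow> b \<bullet> snd p \<le> b \<bullet> snd q"
    using continuous_attains_inf[of ?S "\<lambda>q. b \<bullet> snd q"] by (fastforce intro!: continuous_intros)
  have "b \<bullet> snd p \<le> b \<bullet> v" if "v \<in> K l" for v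
  proof (cases "b \<bullet> v \<le> b \<bullet> w")
    case True
    then show ?thesis
      using p(2)[of "(l, v)"] that assms by (simp add: bounded_solutions_def)
  next
    case False
    then show ?thesis
      using p(1) by (auto simp: bounded_solutions_def)
  qed
  moreover have "snd p \<in> K l"
    using p(1) by (auto simp: bounded_solutions_def)
  ultimately show ?thesis
    by blast
qed

text \<open>By \<open>bounded_bounded_solutions\<close>, an upper bound on the single functional \<open>b \<bullet> u\<close> already bounds
  the whole set of minimizers.\<close>

lemma coercive_if_inner_bounded_on_K:
  assumes "l0 \<le> m" "K m \<noteq> {}" "\<And>u. u \<in> K m \<Longrightarrow> b \<bullet> u \<le> w"
  shows "coercive (J m)"
proof -
  have "K m \<subseteq> snd ` bounded_solutions m w"
    using assms by (force simp: bounded_solutions_def image_iff)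
  then have "bounded (K m)"
    using bounded_bounded_solutions bounded_snd bounded_subset by blast
  with assms show ?thesis
    using coercive_if_bounded_minimizers[OF convex_J continuous_on_J]
    unfolding K_eq_minimizers[OF assms(1)] by blast
qed

section \<open>Solutions with a prescribed value of the linear functional\<close>

text \<open>A solution at \<open>l\<close> with \<open>b \<bullet> u \<le> w\<close> gives \<open>J l v \<ge> J l u \<ge> - w\<close> for all \<open>v\<close>, because
  \<open>I l \<ge> 0\<close>.\<close>

lemma parameters_bounded:
  assumes "filterlim (\<lambda>l. J l (v l)) at_bot at_top"
  shows "\<exists>N. \<forall>l\<ge>l0. \<forall>u\<in>K l. b \<bullet> u \<le> w \<longrightarrow> l \<le> N"
proof -
  have "eventually (\<lambda>l. J l (v l) < - w) at_top"
    using assms by (simp add: filterlim_at_bot_dense)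
  then obtain N where N: "\<And>l. l \<ge> N \<Longrightarrow> J l (v l) < - w"
    by (auto simp: eventually_at_top_linorder)
  have "l \<le> N" if "l0 \<le> l" "u \<in> K l" "b \<bullet> u \<le> w" for l u
  proof (rule ccontr)
    assume "\<not> l \<le> N"
    then have "J l (v l) < - w"
      by (intro N) simp
    moreover have "J l u \<le> J l (v l)"
      using that K_iff_minimizer by blast
    moreover have "- w \<le> J l u"
      using I_nonneg[OF that(1), of u] that(3) by (simp add: J_fun_def)
    ultimately show False
      by simp
  qed
  then show ?thesis
    by blast
qed

text \<open>At the largest parameter \<open>m\<close> with a solution satisfying \<open>b \<bullet> u \<le> w\<close> there is also one with
  \<open>w \<le> b \<bullet> u\<close>, because otherwise \<open>J m\<close> would be coercive and solutions from the right of \<open>m\<close> would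
  accumulate at one. The value \<open>w\<close> is then attained because \<open>K m\<close> is connected.\<close>

lemma exists_solution_with_value:
  assumes coercive_open: "\<And>m. l0 \<le> m \<Longrightarrow> coercive (J m) \<Longrightarrow> \<exists>\<epsilon>>0. coercive (J (m + \<epsilon>))"
    and unbounded: "filterlim (\<lambda>l. J l (v l)) at_bot at_top"
    and mono: "\<And>l1 l2 u1 u2. l0 \<le> l1 \<Longrightarrow> l1 < l2 \<Longrightarrow> u1 \<in> K l1 \<Longrightarrow> u2 \<in> K l2
      \<Longrightarrow> b \<bullet> u1 \<le> b \<bullet> u2"
    and start: "u0 \<in> K l0" "b \<bullet> u0 \<le> w"
  shows "\<exists>l u. l0 \<le> l \<and> u \<in> K l \<and> b \<bullet> u = w"
proof -
  obtain N where N: "\<And>l u. l0 \<le> l \<Longrightarrow> u \<in> K l \<Longrightarrow> b \<bullet> u \<le> w \<Longrightarrow> l \<le> N"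
    using parameters_bounded[OF unbounded] by blast
  let ?A = "fst ` bounded_solutions N w"
  have A: "l \<in> ?A \<longleftrightarrow> l0 \<le> l \<and> (\<exists>u\<in>K l. b \<bullet> u \<le> w)" for l
    using N by (force simp: bounded_solutions_def image_iff)
  have "compact ?A"
    by (intro compact_continuous_image compact_bounded_solutions continuous_intros)
  moreover have "l0 \<in> ?A"
    using start A by blast
  ultimately obtain m where m: "m \<in> ?A" "\<And>l. l \<in> ?A \<Longrightarrow> l \<le> m"
    using compact_attains_sup[of ?A] by blast
  then obtain u where u: "l0 \<le> m" "u \<in> K m" "b \<bullet> u \<le> w"
    using A by blast
  have "\<exists>u'\<in>K m. w \<le> b \<bullet> u'"
  proof (rule ccontr)
    assume "\<not> ?thesis"
    then have "coercive (J m)"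
      using u by (intro coercive_if_inner_bounded_on_K[of m w]) force+
    then obtain \<epsilon> where \<epsilon>: "\<epsilon> > 0" "coercive (J (m + \<epsilon>))"
      using coercive_open u(1) by blast
    have solvable: "K l \<noteq> {}" if "m < l" "l \<le> m + \<epsilon>" for l
      using that u(1) \<epsilon>(2)
      by (intro coercive_imp_K_nonempty coercive_J_antimono[of l "m + \<epsilon>"]) auto
    have above: "w \<le> b \<bullet> v" if "m < l" "v \<in> K l" for l v
    proof (rule ccontr)
      assume "\<not> w \<le> b \<bullet> v"
      then have "l \<in> ?A"
        unfolding A using that u(1) by (intro conjI bexI[of _ v]) auto
      then have "l \<le> m"
        by (rule m(2))
      with that show False
        by simp
    qed
    obtain u\<epsilon> where u\<epsilon>: "u\<epsilon> \<in> K (m + \<epsilon>)"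
      using solvable[of "m + \<epsilon>"] \<epsilon>(1) by auto
    \<comment> \<open>monotonicity bounds \<open>b \<bullet> v\<close> by its value at \<open>m + \<epsilon>\<close>, so these solutions stay in a compact set\<close>
    let ?T = "bounded_solutions (m + \<epsilon>) (b \<bullet> u\<epsilon>) \<inter> {p. w \<le> b \<bullet> snd p}"
    have "{m<..<m + \<epsilon>} \<subseteq> fst ` ?T"
    proof
      fix l assume l: "l \<in> {m<..<m + \<epsilon>}"
      then obtain v where v: "v \<in> K l"
        using solvable[of l] by auto
      then have "(l, v) \<in> ?T"
        using l u(1) above[of l v] mono[of l "m + \<epsilon>" v u\<epsilon>] u\<epsilon> by (simp add: bounded_solutions_def)
      then show "l \<in> fst ` ?T"
        by force
    qed
    moreover have "closed (fst ` ?T)"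
    proof -
      have "closed {p :: real \<times> 'a. w \<le> b \<bullet> snd p}"
        by (intro closed_Collect_le continuous_intros)
      then have "compact ?T"
        by (rule compact_Int_closed[OF compact_bounded_solutions])
      then show ?thesis
        by (intro compact_imp_closed compact_continuous_image continuous_intros)
    qed
    \<comment> \<open>\<open>m\<close> is a limit of the parameters in \<open>fst ` ?T\<close>\<close>
    ultimately have "closure {m<..<m + \<epsilon>} \<subseteq> fst ` ?T"
      by (rule closure_minimal)
    then have "m \<in> fst ` ?T"
      using \<epsilon>(1) by (auto simp: subset_iff)
    with \<open>\<not> ?thesis\<close> show False
      by (auto simp: bounded_solutions_def)
  qed
  then show ?thesis
    using connected_ivt_hyperplane[OF connected_K[OF u(1)] u(2)] u by blast
qed

section \<open>The solution map\<close>

text \<open>\<open>lambda_star\<close> is defined through solvability on whole intervals, so solvability has to be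
  carried from \<open>l\<close> down to \<open>l0\<close>: a minimizer at \<open>l\<close> bounds \<open>J l\<close> from below, which makes \<open>J\<close>
  coercive at every smaller parameter.\<close>

lemma le_lambda_star_if_solvable:
  assumes coercive_below: "\<And>m l. l0 < m \<Longrightarrow> bdd_below (range (J m)) \<Longrightarrow> l0 \<le> l \<Longrightarrow> l < m
      \<Longrightarrow> coercive (J l)"
    and "l0 \<le> l" "K l \<noteq> {}"
  shows "ereal l \<le> lambda_star F b l0"
proof -
  obtain u where "u \<in> K l"
    using assms by blast
  then have bdd: "bdd_below (range (J l))"
    using K_iff_minimizer assms(2) by (intro bdd_belowI[of _ "J l u"]) auto
  have "K l' \<noteq> {}" if "l' \<in> {l0..l}" for l'
  proof (cases "l' = l")
    case False
    then have "coercive (J l')"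
      using that bdd by (intro coercive_below[of l]) auto
    then show ?thesis
      using that by (intro coercive_imp_K_nonempty) auto
  qed (use assms in simp)
  then show ?thesis
    unfolding lambda_star_def using assms(2) by (intro Sup_upper) auto
qed

text \<open>For \<open>m\<close> close to \<open>lambda_star\<close> and any \<open>u \<in> K m\<close>, levels above \<open>b \<bullet> u\<close> are only taken at
  parameters at least \<open>m\<close>.\<close>

lemma multi_tendsto_psi:
  assumes solvable: "K l0 \<noteq> {}"
    and mono: "\<And>l1 l2 u1 u2. l0 \<le> l1 \<Longrightarrow> l1 < l2 \<Longrightarrow> u1 \<in> K l1 \<Longrightarrow> u2 \<in> K l2
      \<Longrightarrow> b \<bullet> u1 \<le> b \<bullet> u2"
  shows "multi_tendsto (\<lambda>w. ereal ` psi F b l0 w) (lambda_star F b l0) at_top"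
  unfolding multi_tendsto_def
proof (intro allI impI)
  fix U :: "ereal set" assume U: "open U" "lambda_star F b l0 \<in> U"
  have "ereal l0 \<le> lambda_star F b l0"
    unfolding lambda_star_def using solvable by (intro Sup_upper) auto
  then have "- \<infinity> < lambda_star F b l0"
    by (rule less_le_trans[rotated]) simp
  then obtain a where a: "a < lambda_star F b l0" "{a<..lambda_star F b l0} \<subseteq> U"
    using open_left[OF U] by blast
  then obtain m where m: "a < ereal m" "l0 \<le> m" "K m \<noteq> {}"
    unfolding lambda_star_def less_Sup_iff by auto
  then obtain u where u: "u \<in> K m"
    by blast
  have "ereal ` psi F b l0 w \<subseteq> U" if "b \<bullet> u < w" for w
  proof
    fix x assume "x \<in> ereal ` psi F b l0 w"
    then obtain l v where l: "x = ereal l" "l0 \<le> l" "ereal l \<le> lambda_star F b l0" "v \<in> K l" "b \<bullet> v = w"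
      by (auto simp: psi_def K_set_def)
    have "m \<le> l"
      using mono[of l m v u] l u that by force
    then have "a < ereal l"
      using m(1) by (meson ereal_less_eq(3) less_le_trans)
    with l a(2) show "x \<in> U"
      by auto
  qed
  then show "eventually (\<lambda>w. ereal ` psi F b l0 w \<subseteq> U) at_top"
    by (rule eventually_mono[OF eventually_gt_at_top])
qed

text \<open>Over \<open>{w0..W}\<close> the graph of \<open>g\<close> is the image of a compact set of solutions under
  \<open>(l, u) \<mapsto> (b \<bullet> u, l)\<close>, hence closed, and \<open>g\<close> takes its values in \<open>{l0..g W}\<close>.\<close>

lemma continuous_on_parameter_of_value:
  assumes g: "\<And>w l. w0 \<le> w \<Longrightarrow> l0 \<le> l \<and> (\<exists>u\<in>K l. b \<bullet> u = w) \<longleftrightarrow> l = g w"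
    and w0: "\<And>l u. l0 \<le> l \<Longrightarrow> u \<in> K l \<Longrightarrow> w0 \<le> b \<bullet> u"
    and mono: "\<And>w1 w2. w0 \<le> w1 \<Longrightarrow> w1 \<le> w2 \<Longrightarrow> g w1 \<le> g w2"
  shows "continuous_on {w0..} g"
proof -
  have *: "continuous_on {w0..W} g" for W
  proof (rule continuous_from_closed_graph)
    show "compact {l0..g W}"
      by simp
    show "g \<in> {w0..W} \<rightarrow> {l0..g W}"
    proof
      fix w assume "w \<in> {w0..W}"
      then show "g w \<in> {l0..g W}"
        using g[of w "g w"] mono[of w W] by simp
    qed
    have "(\<lambda>w. (w, g w)) ` {w0..W} = (\<lambda>(l, u). (b \<bullet> u, l)) ` bounded_solutions (g W) W"
    proof (intro equalityI subsetI)
      fix p assume "p \<in> (\<lambda>w. (w, g w)) ` {w0..W}"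
      then obtain w where w: "p = (w, g w)" "w0 \<le> w" "w \<le> W"
        by auto
      then obtain u where "l0 \<le> g w" "u \<in> K (g w)" "b \<bullet> u = w"
        using g by blast
      with w have "(g w, u) \<in> bounded_solutions (g W) W" "p = (\<lambda>(l, u). (b \<bullet> u, l)) (g w, u)"
        using mono by (auto simp: bounded_solutions_def)
      then show "p \<in> (\<lambda>(l, u). (b \<bullet> u, l)) ` bounded_solutions (g W) W"
        by blast
    next
      fix p assume "p \<in> (\<lambda>(l, u). (b \<bullet> u, l)) ` bounded_solutions (g W) W"
      then obtain l u where lu: "p = (b \<bullet> u, l)" "l0 \<le> l" "u \<in> K l" "b \<bullet> u \<le> W"
        by (auto simp: bounded_solutions_def)
      then show "p \<in> (\<lambda>w. (w, g w)) ` {w0..W}"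
        using g[of "b \<bullet> u" l] w0[of l u] by auto
    qed
    moreover have "compact \<dots>"
      by (intro compact_continuous_image compact_bounded_solutions)
        (auto simp: case_prod_unfold intro!: continuous_intros)
    ultimately show "closed ((\<lambda>w. (w, g w)) ` {w0..W})"
      by (simp add: compact_imp_closed)
  qed
  show ?thesis
    unfolding continuous_on_eq_continuous_within
  proof
    fix w assume w: "w \<in> {w0..}"
    have "at w within {w0..} = at w within {w0..w + 1}"
      by (rule at_within_nhd[of w "{..<w + 1}"]) auto
    then show "continuous (at w within {w0..}) g"
      using *[of "w + 1"] w by (simp add: continuous_on_eq_continuous_within)
  qed
qed

end

theorem theorem5p5:
  fixes l0 :: real
    and b :: "real ^ 'n"
    and F :: "real \<Rightarrow> real ^ 'n \<Rightarrow> real ^ 'n"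
    and I :: "real \<Rightarrow> real ^ 'n \<Rightarrow> real"
  assumes l0: "0 \<le> l0" "l0 \<le> 1"
    and B1: "b \<noteq> 0"
      "\<And>l. l0 \<le> l \<Longrightarrow> F l 0 = 0"
      "\<And>l. l0 \<le> l \<Longrightarrow> continuous_on UNIV (F l)"
    and B2: "\<And>l. l0 \<le> l \<Longrightarrow> convex_on UNIV (I l)"
      "\<And>l v. l0 \<le> l \<Longrightarrow> GDERIV (I l) v :> F l v"
      "\<And>l. l0 \<le> l \<Longrightarrow> I l 0 = 0"
    and B3i: "coercive (J_fun I b l0)"
    and B3ii: "\<And>m l. l0 < m \<Longrightarrow> bdd_below (range (J_fun I b m)) \<Longrightarrow> l0 \<le> l \<Longrightarrow> l < m
      \<Longrightarrow> coercive (J_fun I b l)"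
    and B3iii: "\<And>m. l0 \<le> m \<Longrightarrow> coercive (J_fun I b m)
      \<Longrightarrow> \<exists>\<epsilon>>0. coercive (J_fun I b (m + \<epsilon>))"
    and B4: "\<And>l. l0 \<le> l \<Longrightarrow> \<exists>c1 c2. c1 > 0 \<and> c2 \<ge> 0 \<and> (\<forall>v. I l v \<ge> c1 * norm v - c2)"
    and B5: "\<And>v l1 l2. l0 \<le> l1 \<Longrightarrow> l1 \<le> l2 \<Longrightarrow> I l2 v \<le> I l1 v"
    and B6: "\<And>ls l vs v. (\<And>n::nat. l0 \<le> ls n) \<Longrightarrow> ls \<longlonglongrightarrow> l \<Longrightarrow> vs \<longlonglongrightarrow> v
      \<Longrightarrow> (\<lambda>n. I (ls n) (vs n)) \<longlonglongrightarrow> I l v"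
    and B7: "\<exists>v. filterlim (\<lambda>l. J_fun I b l (v l)) at_bot at_top"
    and B8: "\<And>l1 l2 u1 u2. l0 \<le> l1 \<Longrightarrow> l1 < l2 \<Longrightarrow> u1 \<in> K_set F b l1 \<Longrightarrow> u2 \<in> K_set F b l2
      \<Longrightarrow> b \<bullet> u1 \<le> b \<bullet> u2"
  shows "(\<exists>u\<in>K_set F b l0. b \<bullet> u = omega0 F b l0) \<and>
    (\<forall>u\<in>K_set F b l0. omega0 F b l0 \<le> b \<bullet> u) \<and>
    (\<forall>w\<ge>omega0 F b l0. \<exists>l u. l0 \<le> l \<and> ereal l \<le> lambda_star F b l0 \<and> F l u = b \<and> b \<bullet> u = w) \<and>
    (\<forall>w1\<ge>omega0 F b l0. \<forall>w2>w1. \<forall>l1\<in>psi F b l0 w1. \<forall>l2\<in>psi F b l0 w2. l1 \<le> l2) \<and>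
    multi_tendsto (\<lambda>w. ereal ` psi F b l0 w) (lambda_star F b l0) at_top \<and>
    ((\<forall>l1 l2. \<forall>u1\<in>K_set F b l1. \<forall>u2\<in>K_set F b l2. l0 \<le> l1 \<longrightarrow> l1 < l2 \<longrightarrow> b \<bullet> u1 < b \<bullet> u2) \<longrightarrow>
      (\<exists>g. (\<forall>w\<ge>omega0 F b l0. psi F b l0 w = {g w}) \<and> continuous_on {omega0 F b l0..} g))"
proof -
  interpret convex_potential_family l0 b F I
    by (rule convex_potential_family.intro) (fact B1(2) B2 B4 B5 B6)+
  obtain v where v: "filterlim (\<lambda>l. J l (v l)) at_bot at_top"
    using B7 by blast
  have solvable: "K l0 \<noteq> {}"
    using B3i by (intro coercive_imp_K_nonempty) auto
  obtain u0 where u0: "u0 \<in> K l0" "\<And>u. u \<in> K l0 \<Longrightarrow> b \<bullet> u0 \<le> b \<bullet> u"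
    using inner_attains_min_on_K[OF order_refl solvable] by blast
  have omega0: "omega0 F b l0 = b \<bullet> u0"
    unfolding omega0_def using u0 by (intro Least_equality) auto
  have le_star: "ereal l \<le> lambda_star F b l0" if "l0 \<le> l" "K l \<noteq> {}" for l
    using B3ii that by (rule le_lambda_star_if_solvable)
  have psi_iff: "l \<in> psi F b l0 w \<longleftrightarrow> l0 \<le> l \<and> (\<exists>u\<in>K l. b \<bullet> u = w)" for l w
    using le_star[of l] unfolding psi_def K_set_def by blast
  have nonempty: "\<exists>l. l \<in> psi F b l0 w" if "omega0 F b l0 \<le> w" for w
  proof -
    have "b \<bullet> u0 \<le> w"
      using that by (simp add: omega0)
    with B3iii v B8 u0(1) have "\<exists>l u. l0 \<le> l \<and> u \<in> K l \<and> b \<bullet> u = w"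
      by (rule exists_solution_with_value)
    then show ?thesis
      by (auto simp: psi_iff)
  qed
  have mono: "l1 \<le> l2" if "w1 < w2" "l1 \<in> psi F b l0 w1" "l2 \<in> psi F b l0 w2" for w1 w2 l1 l2
    using that B8[of l2 l1] unfolding psi_iff by force
  have "\<exists>g. (\<forall>w\<ge>omega0 F b l0. psi F b l0 w = {g w}) \<and> continuous_on {omega0 F b l0..} g"
    if strict: "\<forall>l1 l2. \<forall>u1\<in>K l1. \<forall>u2\<in>K l2. l0 \<le> l1 \<longrightarrow> l1 < l2 \<longrightarrow> b \<bullet> u1 < b \<bullet> u2"
  proof -
    have "l1 = l2" if "l1 \<in> psi F b l0 w" "l2 \<in> psi F b l0 w" for w l1 l2
      using that strict unfolding psi_iff by (metis linorder_cases order_less_irrefl)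
    then have "\<forall>w\<ge>omega0 F b l0. \<exists>l. psi F b l0 w = {l}"
      using nonempty by blast
    then obtain g where g: "\<And>w. omega0 F b l0 \<le> w \<Longrightarrow> psi F b l0 w = {g w}"
      by metis
    have "continuous_on {omega0 F b l0..} g"
    proof (rule continuous_on_parameter_of_value)
      show "l0 \<le> l \<and> (\<exists>u\<in>K l. b \<bullet> u = w) \<longleftrightarrow> l = g w" if "omega0 F b l0 \<le> w" for w l
        using g[OF that] psi_iff by blast
      show "omega0 F b l0 \<le> b \<bullet> u" if "l0 \<le> l" "u \<in> K l" for l u
        using that u0 B8[of l0 l u0 u] by (cases "l = l0") (auto simp: omega0)
      show "g w1 \<le> g w2" if "omega0 F b l0 \<le> w1" "w1 \<le> w2" for w1 w2
        using that mono[of w1 w2 "g w1" "g w2"] g by (cases "w1 = w2") auto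
    qed
    with g show ?thesis
      by blast
  qed
  moreover have "\<exists>l u. l0 \<le> l \<and> ereal l \<le> lambda_star F b l0 \<and> F l u = b \<and> b \<bullet> u = w"
    if "omega0 F b l0 \<le> w" for w
    using nonempty[OF that] unfolding psi_def by blast
  moreover have "multi_tendsto (\<lambda>w. ereal ` psi F b l0 w) (lambda_star F b l0) at_top"
    using solvable B8 by (rule multi_tendsto_psi)
  ultimately show ?thesis
    using u0 mono omega0 by auto
qed

end
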